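(* Let $n\ge k\ge 2$ be integers. For the devoid complex $\mathcal{D}(P_n;P_k)$ the following holds: $$\mathcal{D}(P_n;P_k)\simeq\begin{cases}S^{tk-t-1}, & \text{if } n=(k+1)t \text{ for some integer } t,\\ S^{tk-t+k-2}, & \text{if } n=(k+1)t+k \text{ for some integer } t\ge 0,\\ \ast, & \text{otherwise},\end{cases}$$ where $\ast$ means that the complex is contractible.
   Context: Graphs are finite and undirected. $P_m$ denotes the path graph on $m$ vertices. For a graph $G=(V,E)$ and $S\subseteq V$, $G[S]$ is the subgraph induced by $S$. A graph is $F$-free if it contains no (not necessarily induced) subgraph isomorphic to $F$. The devoid complex $\mathcal{D}(G;F)$ is the simplicial complex on $V$ whose faces are those subsets $S\subseteq V$ such that $G[S]$ is $F$-free. $S^m$ denotes the $m$-dimensional sphere. *)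

theory Defs
  imports "HOL-Analysis.Analysis" "Graph_Theory.Graph_Theory"
begin

text \<open>
  As in \<^theory>\<open>Graph_Theory.Digraph\<close>, an undirected graph is a symmetric loop-free digraph without
  parallel arcs (locale \<^locale>\<open>graph\<close>): each edge is a pair of opposite arcs. A sub-digraph that is
  isomorphic to an undirected graph is itself symmetric, so for such graphs \<^const>\<open>subgraph\<close>
  combined with \<open>digraph_iso\<close> is the usual undirected notion.
\<close>

definition path_graph :: "nat \<Rightarrow> nat pair_pre_digraph" where
  "path_graph m = \<lparr> pverts = {1..m},
     parcs = {(i, j). i \<in> {1..m} \<and> j \<in> {1..m} \<and> (j = Suc i \<or> i = Suc j)} \<rparr>"

lemma pair_graph_path_graph: "pair_graph (path_graph m)"
proof -
  have "finite (parcs (path_graph m))"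
    by (rule finite_subset[of _ "{1..m} \<times> {1..m}"]) (auto simp: path_graph_def)
  then show ?thesis
    unfolding pair_graph_def pair_digraph_def pair_pseudo_graph_def pair_fin_digraph_def
      pair_fin_digraph_axioms_def pair_sym_digraph_def pair_sym_digraph_axioms_def
      pair_loopfree_digraph_def pair_loopfree_digraph_axioms_def pair_wf_digraph_def symmetric_def
    by (auto simp: path_graph_def intro: symI)
qed

definition free_of :: "('a, 'b) pre_digraph \<Rightarrow> ('c, 'd) pre_digraph \<Rightarrow> bool" where
  "free_of F G \<longleftrightarrow> \<not> (\<exists>H. subgraph H G \<and> digraph_iso H F)"

text \<open>Simplicial complexes are given by their sets of faces, the empty face included.\<close>

definition devoid_complex :: "('a, 'b) pre_digraph \<Rightarrow> ('c, 'd) pre_digraph \<Rightarrow> 'a set set" where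
  "devoid_complex G F = {S. S \<subseteq> verts G \<and> free_of F (G \<restriction> S)}"

lemma devoid_complex_subset_closed:
  assumes "wf_digraph G" "S \<in> devoid_complex G F" "T \<subseteq> S"
  shows "T \<in> devoid_complex G F"
proof -
  interpret wf_digraph G by fact
  have "subgraph (G \<restriction> T) (G \<restriction> S)"
    using \<open>T \<subseteq> S\<close> by (auto simp: subgraph_def compatible_def)
  then have "subgraph H (G \<restriction> S)" if "subgraph H (G \<restriction> T)" for H
    using that by (rule subgraph_trans[rotated])
  then show ?thesis
    using assms(2,3) unfolding devoid_complex_def free_of_def by blast
qed

text \<open>
  Points are given by their barycentric coordinates. The topology is that of pointwise convergence,
  which is the usual one for complexes with finitely many vertices. If the support of \<open>x\<close> is
  infinite, the sum below is \<open>0\<close> by convention, so \<open>x\<close> is excluded.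
\<close>

definition geometric_realization :: "'a set set \<Rightarrow> ('a \<Rightarrow> real) topology" where
  "geometric_realization K = subtopology (powertop_real UNIV)
     {x. (\<forall>v. 0 \<le> x v) \<and> {v. x v \<noteq> 0} \<in> K \<and> (\<Sum>v | x v \<noteq> 0. x v) = 1}"

end

theory Submission
  imports Defs
begin

text \<open>
  A set of vertices of a path on \<open>n\<close> vertices induces a subgraph without a path on \<open>k\<close> vertices
  exactly if it has no \<open>k\<close> consecutive elements (\<open>devoid_complex_path_graph\<close>), so the theorem is
  about the complex of subsets of \<open>{1..n}\<close> without a run of length \<open>k\<close>.

  In this complex vertex \<open>k + 1\<close> is dominated by vertex \<open>1\<close>: the only run through \<open>1\<close> is \<open>{1..k}\<close>, and
  a face that contains \<open>k + 1\<close> does not contain all of \<open>{2..k}\<close>. Hence \<open>1\<close> can be added to every face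
  through \<open>k + 1\<close>, and sliding the mass of \<open>k + 1\<close> to \<open>1\<close> is a deformation retraction onto the
  subcomplex without \<open>k + 1\<close> (\<open>homotopy_equivalent_delete_dominated_vertex\<close>). No run crosses the gap
  at \<open>k + 1\<close>, so the argument repeats behind it: all multiples of \<open>k + 1\<close> can be deleted in increasing
  order (\<open>runless_homotopy_equivalent_runless_avoiding\<close>).

  What is left splits into blocks of \<open>k\<close> consecutive vertices, followed by a last block of size
  \<open>n mod (k + 1)\<close>, and a set is a face if and only if it contains no complete block of size \<open>k\<close>. If the
  last block is neither empty nor complete, then \<open>n\<close> is the apex of a cone. Otherwise the complex is
  the join of the boundaries of \<open>T\<close> simplices of dimension \<open>k - 1\<close>, thus a sphere of dimension
  \<open>T * (k - 1) - 1\<close>; \<open>join_of_simplex_boundaries_homeomorphic_nsphere\<close> gives an explicit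
  homeomorphism. Here \<open>T = t\<close> if \<open>n = (k + 1) * t\<close>, and \<open>T = t + 1\<close> if \<open>n = (k + 1) * t + k\<close>.
\<close>

section \<open>Maps into geometric realizations\<close>

lemma topspace_geometric_realization:
  "topspace (geometric_realization K) =
     {x. (\<forall>v. 0 \<le> x v) \<and> {v. x v \<noteq> 0} \<in> K \<and> (\<Sum>v | x v \<noteq> 0. x v) = 1}"
  by (simp add: geometric_realization_def)

text \<open>
  Summing over a fixed finite set instead of the support makes the last condition linear in \<open>x\<close>.
\<close>

lemma mem_topspace_geometric_realization:
  assumes "finite W" "K \<subseteq> Pow W"
  shows "x \<in> topspace (geometric_realization K) \<longleftrightarrow>
     (\<forall>v. 0 \<le> x v) \<and> {v. x v \<noteq> 0} \<in> K \<and> sum x W = 1"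
proof -
  have "(\<Sum>v | x v \<noteq> 0. x v) = sum x W" if "{v. x v \<noteq> 0} \<in> K"
    by (rule sum.mono_neutral_left) (use assms that in auto)
  then show ?thesis
    by (auto simp: topspace_geometric_realization)
qed

lemma continuous_map_into_geometric_realization:
  "continuous_map X (geometric_realization K) f \<longleftrightarrow>
     (\<forall>v. continuous_map X euclideanreal (\<lambda>x. f x v)) \<and>
     f \<in> topspace X \<rightarrow> topspace (geometric_realization K)"
  by (simp add: topspace_geometric_realization)
     (auto simp: geometric_realization_def continuous_map_in_subtopology
        continuous_map_componentwise_UNIV)

lemma continuous_map_barycentric_coordinate:
  "continuous_map (geometric_realization K) euclideanreal (\<lambda>x. x v)"
  unfolding geometric_realization_def
  by (intro continuous_map_from_subtopology continuous_map_product_projection) simp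

section \<open>Straight-line homotopies\<close>

text \<open>
  For each \<open>x\<close> the segment from \<open>f x\<close> to \<open>x\<close> lies in the closed simplex spanned by both supports.
\<close>

lemma homotopic_id_if_contiguous:
  assumes W: "finite W" "K \<subseteq> Pow W"
    and down: "\<And>S T. S \<in> K \<Longrightarrow> T \<subseteq> S \<Longrightarrow> T \<in> K"
    and f: "continuous_map (geometric_realization K) (geometric_realization K) f"
    and contiguous: "\<And>x. x \<in> topspace (geometric_realization K) \<Longrightarrow>
           {v. x v \<noteq> 0} \<union> {v. f x v \<noteq> 0} \<in> K"
  shows "homotopic_with (\<lambda>_. True) (geometric_realization K) (geometric_realization K) f id"
proof -
  let ?X = "geometric_realization K"
  define h where "h = (\<lambda>(t::real, x) v. (1 - t) * f x v + t * x v)"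
  have fX: "f x \<in> topspace ?X" if "x \<in> topspace ?X" for x
    using continuous_map_image_subset_topspace[OF f] that by blast
  have h_mem: "h (t, x) \<in> topspace ?X" if t: "t \<in> {0..1}" and x: "x \<in> topspace ?X" for t x
  proof -
    note x' = x[unfolded mem_topspace_geometric_realization[OF W]]
    note fx' = fX[OF x, unfolded mem_topspace_geometric_realization[OF W]]
    have "{v. h (t, x) v \<noteq> 0} \<subseteq> {v. x v \<noteq> 0} \<union> {v. f x v \<noteq> 0}"
      by (auto simp: h_def)
    then have "{v. h (t, x) v \<noteq> 0} \<in> K"
      using down contiguous[OF x] by blast
    moreover have "sum (h (t, x)) W = 1"
      using x' fx' by (simp add: h_def sum.distrib flip: sum_distrib_left)
    ultimately show ?thesis
      using x' fx' t by (simp add: mem_topspace_geometric_realization[OF W] h_def)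
  qed
  have "continuous_map (prod_topology (top_of_set {0..1}) ?X) ?X h"
    unfolding continuous_map_into_geometric_realization
  proof (intro conjI allI)
    fix v
    let ?P = "prod_topology (top_of_set {0..1::real}) ?X"
    have t: "continuous_map ?P euclideanreal fst"
      using continuous_map_fst continuous_map_into_fulltopology by blast
    have x: "continuous_map ?P euclideanreal (\<lambda>p. snd p v)"
      using continuous_map_compose[OF continuous_map_snd continuous_map_barycentric_coordinate]
      by (simp add: o_def)
    have fx: "continuous_map ?P euclideanreal (\<lambda>p. f (snd p) v)"
      using continuous_map_compose[OF continuous_map_compose[OF continuous_map_snd f]
          continuous_map_barycentric_coordinate]
      by (simp add: o_def)
    have "continuous_map ?P euclideanreal (\<lambda>p. (1 - fst p) * f (snd p) v + fst p * snd p v)"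
      by (intro continuous_intros t x fx) simp
    then show "continuous_map ?P euclideanreal (\<lambda>p. h p v)"
      by (simp add: h_def case_prod_unfold)
  qed (use h_mem in auto)
  then show ?thesis
    unfolding homotopic_with_def by (intro exI[of _ h]) (auto simp: h_def)
qed

text \<open>
  The map that moves the mass at \<open>v\<close> to \<open>a\<close> fixes every point whose support avoids \<open>v\<close>; at all other
  points the support together with \<open>a\<close> is still a face, so the map is contiguous to the identity.
\<close>

lemma homotopy_equivalent_delete_dominated_vertex:
  assumes W: "finite W" "K \<subseteq> Pow W"
    and down: "\<And>S T. S \<in> K \<Longrightarrow> T \<subseteq> S \<Longrightarrow> T \<in> K"
    and "a \<noteq> v"
    and dom: "\<And>S. S \<in> K \<Longrightarrow> v \<in> S \<Longrightarrow> insert a S \<in> K"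
  shows "geometric_realization K homotopy_equivalent_space geometric_realization {S \<in> K. v \<notin> S}"
proof -
  let ?L = "{S \<in> K. v \<notin> S}"
  let ?X = "geometric_realization K" and ?Y = "geometric_realization ?L"
  define r where "r = (\<lambda>x::'a \<Rightarrow> real. x(v := 0, a := x a + x v))"
  have WL: "?L \<subseteq> Pow W" using W by auto
  note memX = mem_topspace_geometric_realization[OF W]
  note memY = mem_topspace_geometric_realization[OF W(1) WL]
  have YX: "topspace ?Y \<subseteq> topspace ?X"
    by (auto simp: topspace_geometric_realization)
  have supp: "{w. x w \<noteq> 0} \<union> {w. r x w \<noteq> 0} \<in> K" if x: "x \<in> topspace ?X" for x
  proof (cases "x v = 0")
    case True
    then have "r x = x" by (auto simp: r_def)
    then show ?thesis using x by (simp add: memX)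
  next
    case False
    then have "insert a {w. x w \<noteq> 0} \<in> K"
      using x by (intro dom) (auto simp: memX)
    then show ?thesis
      by (rule down) (auto simp: r_def)
  qed
  have rY: "r x \<in> topspace ?Y" if x: "x \<in> topspace ?X" for x
  proof -
    have nonneg: "\<forall>w. 0 \<le> x w" and "sum x W = 1" using x by (auto simp: memX)
    have "{w. r x w \<noteq> 0} \<in> K"
      using supp[OF x] by (rule down) auto
    moreover have "r x v = 0" using \<open>a \<noteq> v\<close> by (simp add: r_def)
    moreover have "sum (r x) W = 1"
    proof (cases "x v = 0")
      case True
      then have "r x = x" by (auto simp: r_def)
      then show ?thesis using \<open>sum x W = 1\<close> by simp
    next
      case False
      have "insert a {w. x w \<noteq> 0} \<in> K"
        using x False by (intro dom) (auto simp: memX)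
      then have "a \<in> W" "v \<in> W" using W False by auto
      have split: "sum g W = g a + g v + sum g (W - {a, v})" for g :: "'a \<Rightarrow> real"
        using W(1) \<open>a \<in> W\<close> \<open>v \<in> W\<close> \<open>a \<noteq> v\<close>
        by (simp add: sum.subset_diff[of "{a, v}" W])
      have "sum (r x) (W - {a, v}) = sum x (W - {a, v})"
        by (rule sum.cong) (auto simp: r_def)
      then show ?thesis
        using split[of x] split[of "r x"] \<open>sum x W = 1\<close> \<open>a \<noteq> v\<close> by (simp add: r_def)
    qed
    ultimately show ?thesis
      using nonneg by (auto simp: memY r_def)
  qed
  have coord: "continuous_map ?X euclideanreal (\<lambda>x. r x w)" for w
    by (cases "w = a"; cases "w = v")
       (auto simp: r_def intro!: continuous_intros continuous_map_barycentric_coordinate)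
  have contY: "continuous_map ?X ?Y r"
    using coord rY by (auto simp: continuous_map_into_geometric_realization)
  have contX: "continuous_map ?X ?X r"
    using coord rY YX by (auto simp: continuous_map_into_geometric_realization)
  have "homotopic_with (\<lambda>_. True) ?X ?X r id"
    by (rule homotopic_id_if_contiguous[OF W down contX supp])
  moreover have "retraction_maps ?X ?Y r id"
    unfolding retraction_maps_def
  proof (intro conjI ballI)
    show "continuous_map ?Y ?X id"
      using YX by (auto simp: continuous_map_into_geometric_realization
          continuous_map_barycentric_coordinate)
    show "r (id x) = x" if "x \<in> topspace ?Y" for x
      using that by (auto simp: memY r_def)
  qed (rule contY)
  ultimately show ?thesis
    by (rule deformation_retract_imp_homotopy_equivalent_space)
qed

text \<open>The constant map to the apex is contiguous to the identity.\<close>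

lemma contractible_space_cone:
  assumes W: "finite W" "K \<subseteq> Pow W"
    and down: "\<And>S T. S \<in> K \<Longrightarrow> T \<subseteq> S \<Longrightarrow> T \<in> K"
    and apex: "\<And>S. S \<in> K \<Longrightarrow> insert a S \<in> K"
  shows "contractible_space (geometric_realization K)"
proof -
  let ?X = "geometric_realization K"
  define e :: "'a \<Rightarrow> real" where "e = (\<lambda>v. if v = a then 1 else 0)"
  have supp_e: "{v. e v \<noteq> 0} = {a}" by (auto simp: e_def)
  have e_mem: "e \<in> topspace ?X" if "x \<in> topspace ?X" for x
  proof -
    have "insert a {v. x v \<noteq> 0} \<in> K"
      using that by (intro apex) (simp add: topspace_geometric_realization)
    then have "{a} \<in> K" by (rule down) auto
    then show ?thesis
      by (auto simp: topspace_geometric_realization supp_e e_def)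
  qed
  have "homotopic_with (\<lambda>_. True) ?X ?X (\<lambda>_. e) id"
  proof (rule homotopic_id_if_contiguous[OF W down])
    show "continuous_map ?X ?X (\<lambda>_. e)"
      unfolding continuous_map_into_geometric_realization using e_mem by auto
    show "{v. x v \<noteq> 0} \<union> {v. e v \<noteq> 0} \<in> K" if "x \<in> topspace ?X" for x
      using apex[of "{v. x v \<noteq> 0}"] that
      by (simp add: supp_e topspace_geometric_realization)
  qed
  then show ?thesis
    unfolding contractible_space_def using homotopic_with_symD by blast
qed

section \<open>Sets of integers without long runs\<close>

definition runless :: "nat \<Rightarrow> nat \<Rightarrow> nat set set" where
  "runless n k = {S. S \<subseteq> {1..n} \<and> (\<forall>j. \<not> {j..<j + k} \<subseteq> S)}"

text \<open>
  A self-avoiding walk on the integers can leave the interval that it has visited only at one of its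
  ends, so this interval grows by one at every step.
\<close>

lemma unit_step_injection_image_interval:
  fixes g :: "nat \<Rightarrow> nat"
  assumes "1 \<le> m" "inj_on g {1..m}"
    and "\<And>i. 1 \<le> i \<Longrightarrow> i < m \<Longrightarrow> g (Suc i) = Suc (g i) \<or> g i = Suc (g (Suc i))"
  shows "\<exists>j. g ` {1..m} = {j..<j + m}"
  using assms
proof (induction m rule: dec_induct)
  case base
  then show ?case by (intro exI[of _ "g 1"]) auto
next
  case (step m)
  have "inj_on g {1..m}"
    using step.prems(1) by (rule inj_on_subset) auto
  then obtain j where j: "g ` {1..m} = {j..<j + m}"
    using step.IH step.prems(2) by (meson less_Suc_eq)
  have ins: "g ` {1..Suc m} = insert (g (Suc m)) {j..<j + m}"
    using j by (simp add: atLeastAtMostSuc_conv)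
  have "g m \<in> {j..<j + m}"
    using j step.hyps by auto
  moreover have "g (Suc m) \<notin> {j..<j + m}"
    unfolding j[symmetric] using step.prems(1) by (fastforce simp: inj_on_def)
  moreover have "g (Suc m) = Suc (g m) \<or> g m = Suc (g (Suc m))"
    using step by auto
  ultimately consider "g (Suc m) = j + m" | "Suc (g (Suc m)) = j"
    by fastforce
  then show ?case
  proof cases
    case 1
    then have "g ` {1..Suc m} = {j..<j + Suc m}" unfolding ins by auto
    then show ?thesis ..
  next
    case 2
    then have "g ` {1..Suc m} = {g (Suc m)..<g (Suc m) + Suc m}" unfolding ins by auto
    then show ?thesis ..
  qed
qed

text \<open>
  The inverse of the isomorphism, restricted to vertices, is a self-avoiding walk on the integers.
\<close>

lemma run_if_contains_path:
  assumes "1 \<le> k" and "subgraph H (with_proj (path_graph n) \<restriction> S)"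
    and "digraph_iso H (with_proj (path_graph k))"
  shows "\<exists>j. {j..<j + k} \<subseteq> S"
proof -
  obtain f where f: "pre_digraph.digraph_isomorphism H f"
    and P: "with_proj (path_graph k) = app_iso f H"
    using assms(3) by (auto simp: digraph_iso_def)
  have V: "iso_verts f ` verts H = {1..k}"
    using arg_cong[OF P, of verts] by (simp add: path_graph_def)
  have A: "iso_arcs f ` arcs H = parcs (path_graph k)"
    using arg_cong[OF P, of arcs] by simp
  have tl: "iso_tail f = fst" and hd: "iso_head f = snd"
    using arg_cong[OF P, of tail] arg_cong[OF P, of head] by simp_all
  have inj: "inj_on (iso_verts f) (verts H)" and wf: "wf_digraph H"
    using f by (auto simp: pre_digraph.digraph_isomorphism_def)
  have tH: "tail H = fst" and hH: "head H = snd" and VS: "verts H \<subseteq> S"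
    and AH: "arcs H \<subseteq> parcs (path_graph n)"
    using assms(2) by (auto simp: subgraph_def compatible_def induce_subgraph_def)
  define g where "g = the_inv_into (verts H) (iso_verts f)"
  have gf: "g (iso_verts f u) = u" if "u \<in> verts H" for u
    unfolding g_def using inj that by (rule the_inv_into_f_f)
  have g_img: "g ` {1..k} = verts H"
    unfolding V[symmetric] using gf by (force simp: image_image)
  have "inj_on g {1..k}"
    unfolding V[symmetric] g_def using inj by (rule inj_on_the_inv_into)
  moreover have "g (Suc i) = Suc (g i) \<or> g i = Suc (g (Suc i))" if "1 \<le> i" "i < k" for i
  proof -
    have "(i, Suc i) \<in> iso_arcs f ` arcs H"
      unfolding A using that by (auto simp: path_graph_def)
    then obtain a where a: "a \<in> arcs H" "iso_arcs f a = (i, Suc i)" by auto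
    have "iso_verts f (fst a) = i" "iso_verts f (snd a) = Suc i"
      using f a by (auto simp: pre_digraph.digraph_isomorphism_def tH hH tl hd)
    moreover have "fst a \<in> verts H" "snd a \<in> verts H"
      using wf_digraph.tail_in_verts[OF wf a(1)] wf_digraph.head_in_verts[OF wf a(1)]
      by (simp_all add: tH hH)
    ultimately have "a = (g i, g (Suc i))"
      using gf by (metis prod.collapse)
    then show ?thesis
      using a(1) AH by (auto simp: path_graph_def)
  qed
  ultimately obtain j where "g ` {1..k} = {j..<j + k}"
    using unit_step_injection_image_interval[OF assms(1)] by blast
  then have "{j..<j + k} \<subseteq> S"
    using VS g_img by simp
  then show ?thesis ..
qed

lemma contains_path_if_run:
  assumes "{j..<j + k} \<subseteq> S" "S \<subseteq> {1..n}" "1 \<le> k"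
  shows "\<exists>H. subgraph H (with_proj (path_graph n) \<restriction> S) \<and> digraph_iso H (with_proj (path_graph k))"
proof -
  define H where "H = with_proj (path_graph n) \<restriction> {j..<j + k}"
  have j: "1 \<le> j" and jn: "j + k \<le> Suc n"
  proof -
    have "j \<in> {1..n}" "j + k - 1 \<in> {1..n}"
      using assms by (auto simp: subset_iff)
    then show "1 \<le> j" "j + k \<le> Suc n" by auto
  qed
  have wf: "wf_digraph H"
    by (auto simp: H_def induce_subgraph_def wf_digraph_def)
  have "subgraph H (with_proj (path_graph n) \<restriction> S)"
    using wf assms(1)
    by (auto simp: subgraph_def compatible_def H_def induce_subgraph_def wf_digraph_def)
  moreover have "digraph_iso H (with_proj (path_graph k))"
  proof -
    define s where "s = (\<lambda>v. Suc v - j)"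
    define f where "f = \<lparr>iso_verts = s, iso_arcs = map_prod s s, iso_head = snd, iso_tail = fst\<rparr>"
    have arcs: "arcs H = {(u, v). u \<in> {j..<j + k} \<and> v \<in> {j..<j + k} \<and> (v = Suc u \<or> u = Suc v)}"
      using j jn by (auto simp: H_def path_graph_def)
    have inj_s: "inj_on s {j..<j + k}"
      by (auto simp: inj_on_def s_def)
    have "inj_on (map_prod s s) (arcs H)"
      by (rule inj_on_subset[OF map_prod_inj_on[OF inj_s inj_s]]) (auto simp: arcs)
    then have "pre_digraph.digraph_isomorphism H f"
      using wf inj_s
      by (auto simp: pre_digraph.digraph_isomorphism_def f_def H_def)
    moreover have "s ` {j..<j + k} = {1..k}"
    proof
      show "{1..k} \<subseteq> s ` {j..<j + k}"
      proof
        fix i assume "i \<in> {1..k}"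
        then show "i \<in> s ` {j..<j + k}"
          using j by (intro image_eqI[of _ _ "i + j - 1"]) (auto simp: s_def)
      qed
    qed (auto simp: s_def)
    moreover have "map_prod s s ` arcs H = parcs (path_graph k)"
    proof
      show "parcs (path_graph k) \<subseteq> map_prod s s ` arcs H"
      proof
        fix p assume "p \<in> parcs (path_graph k)"
        then show "p \<in> map_prod s s ` arcs H"
          using j by (intro image_eqI[of _ _ "(fst p + j - 1, snd p + j - 1)"])
            (auto simp: s_def arcs path_graph_def)
      qed
    qed (auto simp: s_def arcs path_graph_def)
    ultimately show ?thesis
      unfolding digraph_iso_def
      by (intro exI[of _ f] conjI) (auto simp: app_iso_def f_def H_def path_graph_def with_proj_def)
  qed
  ultimately show ?thesis by blast
qed

lemma devoid_complex_path_graph: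
  assumes "1 \<le> k"
  shows "devoid_complex (with_proj (path_graph n)) (with_proj (path_graph k)) = runless n k"
proof -
  have verts: "verts (with_proj (path_graph n)) = {1..n}"
    by (simp add: path_graph_def)
  have "free_of (with_proj (path_graph k)) (with_proj (path_graph n) \<restriction> S) \<longleftrightarrow>
      (\<forall>j. \<not> {j..<j + k} \<subseteq> S)" if "S \<subseteq> {1..n}" for S
    unfolding free_of_def
    using run_if_contains_path[OF assms] contains_path_if_run[OF _ that assms] by metis
  then show ?thesis
    unfolding devoid_complex_def runless_def verts by blast
qed

definition runless_avoiding :: "nat \<Rightarrow> nat \<Rightarrow> nat \<Rightarrow> nat set set" where
  "runless_avoiding n k s = {S \<in> runless n k. \<forall>i\<in>{1..s}. i * (k + 1) \<notin> S}"

lemma runless_subset: "runless n k \<subseteq> Pow {1..n}"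
  by (auto simp: runless_def)

lemma runless_avoiding_subset: "runless_avoiding n k s \<subseteq> Pow {1..n}"
  using runless_subset by (auto simp: runless_avoiding_def)

lemma runless_avoiding_down_closed:
  assumes "S \<in> runless_avoiding n k s" "T \<subseteq> S"
  shows "T \<in> runless_avoiding n k s"
  using assms unfolding runless_avoiding_def runless_def by blast

text \<open>
  Let \<open>a = s * (k + 1) + 1\<close>. As \<open>a - 1\<close> is a deleted vertex (or \<open>0\<close>), a run that is created by adding
  \<open>a\<close> starts at \<open>a\<close>. Shifted by one it ends at \<open>a + k = (s + 1) * (k + 1)\<close>, which belongs to \<open>S\<close>, so the
  shifted run would already lie in \<open>S\<close>.
\<close>

lemma next_multiple_dominated:
  assumes S: "S \<in> runless_avoiding n k s" and v: "(s + 1) * (k + 1) \<in> S"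
  shows "insert (s * (k + 1) + 1) S \<in> runless_avoiding n k s"
proof -
  define a where "a = s * (k + 1) + 1"
  have v_eq: "(s + 1) * (k + 1) = a + k"
    by (simp add: a_def algebra_simps)
  have Sn: "S \<subseteq> {1..n}" and no_run: "\<not> {j..<j + k} \<subseteq> S" for j
    using S by (auto simp: runless_avoiding_def runless_def)
  have "a + k \<le> n"
    using v Sn unfolding v_eq by auto
  then have "a \<in> {1..n}" by (simp add: a_def)
  have "\<not> {j..<j + k} \<subseteq> insert a S" for j
  proof
    assume run: "{j..<j + k} \<subseteq> insert a S"
    then have "a \<in> {j..<j + k}" using no_run[of j] by auto
    have "a - 1 \<notin> insert a S"
    proof (cases "s = 0")
      case True
      then show ?thesis using Sn by (auto simp: a_def)
    next
      case False
      then show ?thesis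
        using S by (auto simp: a_def runless_avoiding_def)
    qed
    then have "a - 1 \<notin> {j..<j + k}" using run by blast
    with \<open>a \<in> {j..<j + k}\<close> have "j = a" by auto
    have "{a + 1..<a + 1 + k} \<subseteq> S"
    proof
      fix x assume x: "x \<in> {a + 1..<a + 1 + k}"
      show "x \<in> S"
      proof (cases "x = a + k")
        case True
        then show ?thesis using v unfolding v_eq by simp
      next
        case False
        then have "x \<in> {j..<j + k}" "x \<noteq> a" using x \<open>j = a\<close> by auto
        then show ?thesis using run by blast
      qed
    qed
    then show False using no_run by blast
  qed
  moreover have "i * (k + 1) \<noteq> a" if "i \<in> {1..s}" for i
  proof -
    have "i * (k + 1) \<le> s * (k + 1)" using that by (intro mult_right_mono) auto
    then show ?thesis by (simp add: a_def)
  qed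
  ultimately show ?thesis
    using S \<open>a \<in> {1..n}\<close> Sn unfolding a_def[symmetric]
    by (auto simp: runless_avoiding_def runless_def)
qed

lemma runless_homotopy_equivalent_runless_avoiding:
  assumes "1 \<le> k"
  shows "geometric_realization (runless n k) homotopy_equivalent_space
         geometric_realization (runless_avoiding n k s)"
proof (induction s)
  case 0
  then show ?case by (simp add: runless_avoiding_def homotopy_equivalent_space_refl)
next
  case (Suc s)
  have eq: "runless_avoiding n k (Suc s) =
      {S \<in> runless_avoiding n k s. (s + 1) * (k + 1) \<notin> S}"
    by (auto simp: runless_avoiding_def atLeastAtMostSuc_conv)
  have "geometric_realization (runless_avoiding n k s) homotopy_equivalent_space
      geometric_realization (runless_avoiding n k (Suc s))"
    unfolding eq
  proof (rule homotopy_equivalent_delete_dominated_vertex[OF _ runless_avoiding_subset])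
    show "s * (k + 1) + 1 \<noteq> (s + 1) * (k + 1)"
      using assms by simp
    show "insert (s * (k + 1) + 1) S \<in> runless_avoiding n k s"
      if "S \<in> runless_avoiding n k s" "(s + 1) * (k + 1) \<in> S" for S
      using that by (rule next_multiple_dominated)
    show "B \<in> runless_avoiding n k s"
      if "A \<in> runless_avoiding n k s" "B \<subseteq> A" for A B
      using that by (rule runless_avoiding_down_closed)
  qed simp
  with Suc show ?case
    by (rule homotopy_eqv_trans)
qed

text \<open>
  A run through \<open>n\<close> would have to end at \<open>n\<close> and, having length \<open>k > r\<close>, would contain \<open>(k + 1) * t\<close>,
  which is a deleted vertex (or \<open>0\<close>).
\<close>

lemma insert_last_runless_avoiding:
  assumes n: "n = (k + 1) * t + r" "1 \<le> r" "r < k"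
    and S: "S \<in> runless_avoiding n k t"
  shows "insert n S \<in> runless_avoiding n k t"
proof -
  have Sn: "S \<subseteq> {1..n}" and no_run: "\<not> {j..<j + k} \<subseteq> S" for j
    using S by (auto simp: runless_avoiding_def runless_def)
  have mult: "i * (k + 1) \<noteq> n" if "i \<in> {1..t}" for i
  proof -
    have "i * (k + 1) \<le> t * (k + 1)" using that by (intro mult_right_mono) auto
    then show ?thesis using n by (simp add: mult.commute)
  qed
  have "\<not> {j..<j + k} \<subseteq> insert n S" for j
  proof
    assume run: "{j..<j + k} \<subseteq> insert n S"
    then have "n \<in> {j..<j + k}" using no_run[of j] by blast
    moreover have "j + k - 1 \<le> n"
    proof -
      have "j + k - 1 \<in> {j..<j + k}" using n(3) by simp
      then have "j + k - 1 \<in> insert n S" using run by blast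
      then show ?thesis using Sn by auto
    qed
    ultimately have "n - r \<in> {j..<j + k}" using n(2,3) by auto
    moreover have n_r: "n - r = t * (k + 1)" using n(1) by simp
    ultimately have "t * (k + 1) \<in> insert n S" using run by force
    moreover have "t * (k + 1) \<noteq> n" using n(1,2) by simp
    ultimately have in_S: "t * (k + 1) \<in> S" by blast
    then have "t \<noteq> 0" using Sn by (auto intro: gr0I)
    then have "t \<in> {1..t}" by simp
    then show False
      using S in_S unfolding runless_avoiding_def by blast
  qed
  moreover have "1 \<le> n" using n(1,2) by simp
  ultimately show ?thesis
    using S Sn mult by (auto simp: runless_avoiding_def runless_def)
qed

section \<open>Joins of boundaries of simplices\<close>

text \<open>
  The vertices \<open>V (j, 0), \<dots>, V (j, d)\<close> span the \<open>j\<close>-th of \<open>T\<close> simplices of dimension \<open>d\<close>, and a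
  face of the join is a union of one proper face of each simplex.
\<close>

definition join_of_simplex_boundaries :: "(nat \<times> nat \<Rightarrow> 'a) \<Rightarrow> nat \<Rightarrow> nat \<Rightarrow> 'a set set" where
  "join_of_simplex_boundaries V T d =
     {S. S \<subseteq> V ` ({..<T} \<times> {..d}) \<and> (\<forall>j<T. \<exists>i\<le>d. V (j, i) \<notin> S)}"

lemma continuous_map_Min:
  fixes f :: "'a \<Rightarrow> 'b \<Rightarrow> real"
  assumes "finite I" "I \<noteq> {}" "\<And>i. i \<in> I \<Longrightarrow> continuous_map X euclideanreal (\<lambda>x. f x i)"
  shows "continuous_map X euclideanreal (\<lambda>x. Min (f x ` I))"
  using continuous_map_Inf[OF assms(1,3)] assms(1,2) by (simp add: cInf_eq_Min)

text \<open>
  Consider nonnegative coordinates \<open>x\<close> on the vertices such that every block has minimum \<open>0\<close>. Such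
  \<open>x\<close> form the cone over the realization. Subtracting in each block the last coordinate from the
  others is a bijection from this cone onto a Euclidean space of dimension \<open>T * d\<close>; the inverse
  puts \<open>0\<close> in the last place and then subtracts the minimum of the block. Both maps are positively
  homogeneous, hence rescaling identifies the realization (total mass \<open>1\<close>) with the unit sphere
  (Euclidean norm \<open>1\<close>). In the proof, \<open>y\<close> and \<open>w\<close> are the two homogeneous maps, and \<open>F\<close> and \<open>G\<close> are
  the rescaled ones.
\<close>

lemma join_of_simplex_boundaries_homeomorphic_nsphere:
  fixes V :: "nat \<times> nat \<Rightarrow> 'a"
  assumes "1 \<le> T" "1 \<le> d" and inj: "inj_on V ({..<T} \<times> {..d})"
  shows "geometric_realization (join_of_simplex_boundaries V T d) homeomorphic_space
         nsphere (T * d - 1)"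
proof -
  define N where "N = T * d"
  have N: "1 \<le> N" using assms(1,2) by (simp add: N_def)
  define P where "P = {..<T} \<times> {..d}"
  define W where "W = V ` P"
  define K where "K = join_of_simplex_boundaries V T d"
  have W: "finite W" "K \<subseteq> Pow W"
    by (auto simp: W_def P_def K_def join_of_simplex_boundaries_def)
  \<comment> \<open>The coordinate \<open>m = j * d + i\<close> of the Euclidean space belongs to place \<open>i\<close> of block \<open>j\<close>.\<close>
  define block where "block = (\<lambda>m. m div d)"
  define pos where "pos = (\<lambda>m. m mod d)"
  have block: "block m < T" and pos: "pos m < d" and glue: "block m * d + pos m = m" if "m < N" for m
    using that assms(2) by (auto simp: block_def pos_def N_def less_mult_imp_div_less)
  have index: "j * d + i < N" "block (j * d + i) = j" "pos (j * d + i) = i" if "j < T" "i < d" for i j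
  proof -
    have "j * d + i < Suc j * d" using that by simp
    also have "\<dots> \<le> T * d" using that by (intro mult_right_mono) auto
    finally show "j * d + i < N" by (simp add: N_def)
  qed (use that in \<open>auto simp: block_def pos_def\<close>)

  define nrm :: "(nat \<Rightarrow> real) \<Rightarrow> real" where "nrm = (\<lambda>z. sqrt (\<Sum>m\<le>N - 1. (z m)\<^sup>2))"
  define y :: "('a \<Rightarrow> real) \<Rightarrow> nat \<Rightarrow> real" where
    "y = (\<lambda>x m. if m < N then x (V (block m, pos m)) - x (V (block m, d)) else 0)"
  define F :: "('a \<Rightarrow> real) \<Rightarrow> nat \<Rightarrow> real" where "F = (\<lambda>x m. y x m / nrm (y x))"
  define e :: "(nat \<Rightarrow> real) \<Rightarrow> nat \<Rightarrow> nat \<Rightarrow> real" where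
    "e = (\<lambda>z j i. if i < d then z (j * d + i) else 0)"
  define w :: "(nat \<Rightarrow> real) \<Rightarrow> nat \<times> nat \<Rightarrow> real" where
    "w = (\<lambda>z (j, i). e z j i - Min (e z j ` {..d}))"
  define tot :: "(nat \<Rightarrow> real) \<Rightarrow> real" where "tot = (\<lambda>z. sum (w z) P)"
  define G :: "(nat \<Rightarrow> real) \<Rightarrow> 'a \<Rightarrow> real" where
    "G = (\<lambda>z v. if v \<in> W then w z (inv_into P V v) / tot z else 0)"

  define Y where "Y = nsphere (N - 1)"
  let ?X = "geometric_realization K"
  have memX: "x \<in> topspace ?X \<longleftrightarrow> (\<forall>v. 0 \<le> x v) \<and> {v. x v \<noteq> 0} \<in> K \<and> sum x W = 1" for x
    by (rule mem_topspace_geometric_realization[OF W])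
  have memY: "z \<in> topspace Y \<longleftrightarrow> nrm z = 1 \<and> (\<forall>m\<ge>N. z m = 0)" for z
    using N by (auto simp: Y_def nsphere nrm_def)

  have zero_in_block: "\<exists>i\<le>d. x (V (j, i)) = 0" if "x \<in> topspace ?X" "j < T" for x j
  proof -
    have "{v. x v \<noteq> 0} \<in> K" using that memX by blast
    then show ?thesis using that(2) by (simp add: K_def join_of_simplex_boundaries_def)
  qed
  have G_V: "G z (V p) = w z p / tot z" if "p \<in> P" for z p
    using that inj by (simp add: G_def W_def P_def inv_into_f_f)
  have sum_W: "sum x W = (\<Sum>p\<in>P. x (V p))" for x :: "'a \<Rightarrow> real"
    unfolding W_def using inj by (simp add: sum.reindex P_def)
  have w_nonneg: "0 \<le> w z p" if "p \<in> P" for z p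
    using that by (auto simp: w_def P_def)
  have w_zero: "\<exists>i\<le>d. w z (j, i) = 0" for z j
  proof -
    have "Min (e z j ` {..d}) \<in> e z j ` {..d}" by (rule Min_in) auto
    then obtain i where "i \<le> d" "Min (e z j ` {..d}) = e z j i" by (rule imageE) simp
    then show ?thesis by (auto simp: w_def)
  qed
  have nrm_pos: "0 < nrm z" if "z m \<noteq> 0" "m < N" for z m
  proof -
    have "0 < (z m)\<^sup>2" using that by simp
    also have "\<dots> \<le> (\<Sum>m\<le>N - 1. (z m)\<^sup>2)"
      using that by (intro member_le_sum) auto
    finally show ?thesis by (simp add: nrm_def)
  qed

  \<comment> \<open>If \<open>y x = 0\<close>, then \<open>x\<close> is constant on every block, with minimum \<open>0\<close>, so the total mass is \<open>0\<close>.\<close>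
  have y_pos: "0 < nrm (y x)" if x: "x \<in> topspace ?X" for x
  proof (rule ccontr)
    assume "\<not> 0 < nrm (y x)"
    then have zero: "y x m = 0" if "m < N" for m
      using nrm_pos that by blast
    have "x (V (j, i)) = 0" if "j < T" "i \<le> d" for j i
    proof -
      have same: "x (V (j, i)) = x (V (j, d))" if "i \<le> d" for i
        using zero[of "j * d + i"] index[of j i] \<open>j < T\<close> that
        by (cases "i = d") (auto simp: y_def)
      obtain i' where "i' \<le> d" "x (V (j, i')) = 0"
        using zero_in_block[OF x \<open>j < T\<close>] by blast
      then show ?thesis
        using same[of i'] same[OF \<open>i \<le> d\<close>] by simp
    qed
    then have "sum x W = 0"
      unfolding sum_W by (intro sum.neutral) (auto simp: P_def)
    then show False using x by (simp add: memX)
  qed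

  \<comment> \<open>If \<open>w z = 0\<close>, then \<open>e z\<close> is constant on every block, and its last entry there is \<open>0\<close>.\<close>
  have tot_pos: "0 < tot z" if z: "z \<in> topspace Y" for z
  proof (rule ccontr)
    assume "\<not> 0 < tot z"
    moreover have "0 \<le> tot z" unfolding tot_def using w_nonneg by (rule sum_nonneg)
    ultimately have "sum (w z) P = 0" by (simp add: tot_def)
    then have zero: "w z p = 0" if "p \<in> P" for p
      using that w_nonneg by (subst (asm) sum_nonneg_eq_0_iff) (auto simp: P_def)
    have "z m = 0" if "m < N" for m
    proof -
      have "e z (block m) (pos m) = e z (block m) d"
        using zero[of "(block m, pos m)"] zero[of "(block m, d)"] block[OF that] pos[OF that]
        by (simp add: P_def w_def)
      then show ?thesis
        using pos[OF that] glue[OF that] by (simp add: e_def)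
    qed
    then have "nrm z = 0" using N by (simp add: nrm_def)
    then show False using z by (simp add: memY)
  qed

  have F_mem: "F x \<in> topspace Y" if x: "x \<in> topspace ?X" for x
  proof -
    have "(\<Sum>m\<le>N - 1. (F x m)\<^sup>2) = (\<Sum>m\<le>N - 1. (y x m)\<^sup>2) / (nrm (y x))\<^sup>2"
      by (simp add: F_def power_divide sum_divide_distrib)
    also have "\<dots> = 1"
      using y_pos[OF x] by (simp add: nrm_def sum_nonneg)
    finally show ?thesis
      unfolding memY by (simp add: nrm_def) (simp add: F_def y_def)
  qed

  have G_mem: "G z \<in> topspace ?X" if z: "z \<in> topspace Y" for z
    unfolding memX
  proof (intro conjI allI)
    show "0 \<le> G z v" for v
    proof (cases "v \<in> W")
      case True
      then show ?thesis
        using G_V w_nonneg tot_pos[OF z] by (auto simp: W_def)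
    qed (simp add: G_def)
    have "\<exists>i\<le>d. V (j, i) \<notin> {v. G z v \<noteq> 0}" if "j < T" for j
      using w_zero[of z j] that G_V by (force simp: P_def)
    moreover have "{v. G z v \<noteq> 0} \<subseteq> W" by (auto simp: G_def)
    ultimately show "{v. G z v \<noteq> 0} \<in> K"
      by (auto simp: K_def join_of_simplex_boundaries_def W_def P_def)
    have "sum (G z) W = (\<Sum>p\<in>P. w z p / tot z)"
      unfolding sum_W using G_V by (intro sum.cong) auto
    also have "\<dots> = 1"
      using tot_pos[OF z] by (simp add: tot_def flip: sum_divide_distrib)
    finally show "sum (G z) W = 1" .
  qed

  have GF: "G (F x) = x" if x: "x \<in> topspace ?X" for x
  proof -
    define c where "c = nrm (y x)"
    have c: "0 < c" using y_pos[OF x] by (simp add: c_def)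
    have eF: "e (F x) j i = (x (V (j, i)) - x (V (j, d))) / c" if "j < T" "i \<le> d" for j i
      using that index[of j i] by (cases "i = d") (auto simp: e_def F_def y_def c_def)
    have "w (F x) (j, i) = x (V (j, i)) / c" if j: "j < T" and i: "i \<le> d" for j i
    proof -
      \<comment> \<open>The minimum is attained where \<open>x\<close> vanishes, so subtracting it undoes the shift by \<open>x (V (j, d))\<close>.\<close>
      have "Min (e (F x) j ` {..d}) = - x (V (j, d)) / c"
      proof (rule Min_eqI)
        fix a assume "a \<in> e (F x) j ` {..d}"
        then show "- x (V (j, d)) / c \<le> a"
          using x c j by (auto simp: eF memX field_simps)
      next
        obtain i' where "i' \<le> d" "x (V (j, i')) = 0"
          using zero_in_block[OF x j] by blast
        then show "- x (V (j, d)) / c \<in> e (F x) j ` {..d}"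
          using j by (intro image_eqI[of _ _ i']) (auto simp: eF)
      qed simp
      then show ?thesis
        using eF[OF that] by (simp add: w_def diff_divide_distrib)
    qed
    then have wF: "w (F x) p = x (V p) / c" if "p \<in> P" for p
      using that by (auto simp: P_def)
    then have "tot (F x) = (\<Sum>p\<in>P. x (V p)) / c"
      by (simp add: tot_def sum_divide_distrib)
    also have "\<dots> = 1 / c"
      using x by (simp add: memX flip: sum_W)
    finally have "tot (F x) = 1 / c" .
    show ?thesis
    proof
      fix v
      show "G (F x) v = x v"
      proof (cases "v \<in> W")
        case True
        then show ?thesis
          using c wF G_V \<open>tot (F x) = 1 / c\<close> by (auto simp: W_def)
      next
        case False
        then have "x v = 0" using x W by (auto simp: memX)
        then show ?thesis using False by (simp add: G_def)
      qed
    qed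
  qed

  have FG: "F (G z) = z" if z: "z \<in> topspace Y" for z
  proof -
    have yG: "y (G z) m = z m / tot z" for m
    proof (cases "m < N")
      case True
      then have "(block m, pos m) \<in> P" "(block m, d) \<in> P"
        using block pos by (auto simp: P_def less_imp_le)
      then have "y (G z) m = (e z (block m) (pos m) - e z (block m) d) / tot z"
        using True by (simp add: y_def G_V w_def diff_divide_distrib)
      then show ?thesis
        using pos[OF True] glue[OF True] by (simp add: e_def)
    next
      case False
      then show ?thesis using z by (simp add: y_def memY)
    qed
    have "nrm (y (G z)) = nrm z / tot z"
      using tot_pos[OF z]
      by (simp add: nrm_def yG power_divide real_sqrt_divide flip: sum_divide_distrib)
    then show ?thesis
      using z tot_pos[OF z] by (auto simp: F_def yG memY)
  qed

  have "homeomorphic_maps ?X Y F G"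
    unfolding homeomorphic_maps_def
  proof (intro conjI ballI)
    have y_cont: "continuous_map ?X euclideanreal (\<lambda>x. y x m)" for m
      by (cases "m < N")
         (auto simp: y_def intro!: continuous_map_diff continuous_map_barycentric_coordinate)
    have "continuous_map ?X euclideanreal (\<lambda>x. F x m)" for m
      unfolding F_def nrm_def
      by (intro continuous_map_real_divide continuous_map_sqrt continuous_map_sum
          continuous_map_real_pow y_cont finite_atMost)
         (use y_pos in \<open>force simp: nrm_def\<close>)
    then show "continuous_map ?X Y F"
      using F_mem
      by (auto simp: Y_def nsphere continuous_map_in_subtopology continuous_map_componentwise_UNIV)
    have e_cont: "continuous_map Y euclideanreal (\<lambda>z. e z j i)" for j i
      by (cases "i < d") (auto simp: e_def Y_def intro: continuous_map_nsphere_projection)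
    have w_cont: "continuous_map Y euclideanreal (\<lambda>z. w z p)" for p
      unfolding w_def case_prod_unfold
      by (intro continuous_map_diff continuous_map_Min e_cont) auto
    have "continuous_map Y euclideanreal (\<lambda>z. G z v)" for v
    proof (cases "v \<in> W")
      case True
      have "continuous_map Y euclideanreal (\<lambda>z. w z (inv_into P V v) / tot z)"
        by (intro continuous_map_real_divide w_cont, unfold tot_def,
            intro continuous_map_sum w_cont)
           (use tot_pos in \<open>force simp: P_def tot_def\<close>)+
      then show ?thesis using True by (simp add: G_def)
    qed (simp add: G_def)
    then show "continuous_map Y ?X G"
      using G_mem by (auto simp: continuous_map_into_geometric_realization)
  qed (use GF FG in auto)
  then show ?thesis
    unfolding homeomorphic_space_def K_def N_def Y_def by blast
qed

section \<open>The homotopy type of the devoid complex of a path\<close>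

text \<open>
  A run of length \<open>k\<close> without multiples of \<open>k + 1\<close> fills the gap between two consecutive multiples.
  The two values of \<open>n\<close> give the same complex, since the vertex \<open>(k + 1) * T\<close> is deleted if it exists.
\<close>

lemma runless_avoiding_eq_join_of_simplex_boundaries:
  assumes k: "1 \<le> k" and n: "n = (k + 1) * T \<or> n + 1 = (k + 1) * T"
  shows "runless_avoiding n k T =
         join_of_simplex_boundaries (\<lambda>(j, i). j * (k + 1) + 1 + i) T (k - 1)"
    (is "?L = join_of_simplex_boundaries ?V T (k - 1)")
proof (intro equalityI subsetI)
  fix S assume S: "S \<in> ?L"
  then have Sn: "S \<subseteq> {1..n}" and no_run: "\<not> {j..<j + k} \<subseteq> S" for j
    by (auto simp: runless_avoiding_def runless_def)
  have no_mult: "i * (k + 1) \<notin> S" if "i \<le> T" for i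
  proof (cases "i = 0")
    case False
    then show ?thesis using S that by (simp add: runless_avoiding_def)
  qed (use Sn in auto)
  have "x \<in> ?V ` ({..<T} \<times> {..k - 1})" if "x \<in> S" for x
  proof -
    define q r where "q = x div (k + 1)" and "r = x mod (k + 1)"
    have x: "x = q * (k + 1) + r"
      unfolding q_def r_def by (rule div_mult_mod_eq[symmetric])
    have "r \<le> k"
      unfolding r_def using mod_less_divisor[of "k + 1" x] by simp
    have "x \<le> (k + 1) * T" using Sn that n by auto
    then have "q \<le> T"
      unfolding q_def by (metis div_le_mono div_mult_self1_is_m k add_gr_0 zero_less_one)
    then have "r \<noteq> 0" using x that no_mult[of q] by (metis add_0_right)
    then have "q \<noteq> T" using x \<open>x \<le> (k + 1) * T\<close> by (auto simp: mult.commute)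
    then show ?thesis
      using x \<open>r \<le> k\<close> \<open>q \<le> T\<close> \<open>r \<noteq> 0\<close> by (intro image_eqI[of _ _ "(q, r - 1)"]) auto
  qed
  moreover have "\<exists>i\<le>k - 1. ?V (j, i) \<notin> S" for j
  proof -
    obtain x where "x \<in> {j * (k + 1) + 1..<j * (k + 1) + 1 + k}" "x \<notin> S"
      using no_run[of "j * (k + 1) + 1"] by blast
    then show ?thesis
      by (intro exI[of _ "x - (j * (k + 1) + 1)"]) auto
  qed
  ultimately show "S \<in> join_of_simplex_boundaries ?V T (k - 1)"
    by (auto simp: join_of_simplex_boundaries_def)
next
  fix S assume S: "S \<in> join_of_simplex_boundaries ?V T (k - 1)"
  have form: "\<exists>j<T. \<exists>i<k. x = j * (k + 1) + 1 + i" if "x \<in> S" for x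
    using S that k by (fastforce simp: join_of_simplex_boundaries_def)
  have no_mult: "q * (k + 1) \<notin> S" for q
  proof
    assume "q * (k + 1) \<in> S"
    then obtain j i where "i < k" "q * (k + 1) = j * (k + 1) + (1 + i)"
      using form by fastforce
    then have "(j * (k + 1) + (1 + i)) mod (k + 1) = 0"
      by (metis mod_mult_self2_is_0)
    moreover have "(j * (k + 1) + (1 + i)) mod (k + 1) = 1 + i"
      unfolding mod_mult_self3 using \<open>i < k\<close> by simp
    ultimately show False by simp
  qed
  have "x \<in> {1..n}" if "x \<in> S" for x
  proof -
    obtain j i where ji: "j < T" "i < k" "x = j * (k + 1) + 1 + i"
      using form[OF \<open>x \<in> S\<close>] by blast
    have "Suc j * (k + 1) \<le> T * (k + 1)"
      using ji(1) by (intro mult_right_mono) auto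
    then show ?thesis using ji n by (auto simp: mult.commute)
  qed
  moreover have "\<not> {x..<x + k} \<subseteq> S" for x
  proof
    assume run: "{x..<x + k} \<subseteq> S"
    then have "x \<in> S" using k by auto
    then obtain j i where ji: "j < T" "i < k" "x = j * (k + 1) + 1 + i"
      using form by blast
    have "i = 0"
    proof (rule ccontr)
      assume "i \<noteq> 0"
      then have "Suc j * (k + 1) \<in> {x..<x + k}" using ji by auto
      then show False using run no_mult by blast
    qed
    obtain i' where "i' \<le> k - 1" "?V (j, i') \<notin> S"
      using S ji(1) by (auto simp: join_of_simplex_boundaries_def)
    moreover have "?V (j, i') \<in> {x..<x + k}"
      using ji \<open>i = 0\<close> \<open>i' \<le> k - 1\<close> by auto
    ultimately show False using run by blast
  qed
  ultimately show "S \<in> ?L"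
    using no_mult by (auto simp: runless_avoiding_def runless_def)
qed

lemma runless_homotopy_equivalent_nsphere:
  assumes k: "2 \<le> k" and T: "1 \<le> T" and n: "n = (k + 1) * T \<or> n + 1 = (k + 1) * T"
  shows "geometric_realization (runless n k) homotopy_equivalent_space nsphere (T * (k - 1) - 1)"
proof -
  let ?V = "\<lambda>(j, i). j * (k + 1) + 1 + i"
  have "inj_on ?V ({..<T} \<times> {..k - 1})"
  proof (rule inj_onI)
    fix p q assume "p \<in> {..<T} \<times> {..k - 1}" "q \<in> {..<T} \<times> {..k - 1}" "?V p = ?V q"
    then obtain a b c d where p: "p = (a, b)" "b < k" and q: "q = (c, d)" "d < k"
      and eq: "b + a * (k + 1) = d + c * (k + 1)"
      using k by (cases p; cases q) auto
    have "(b + a * (k + 1)) div (k + 1) = a" "(d + c * (k + 1)) div (k + 1) = c"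
      using p q by (subst div_mult_self1; simp)+
    then have "a = c" using eq by metis
    then show "p = q" using eq p q by simp
  qed
  then have "geometric_realization (runless_avoiding n k T) homeomorphic_space
      nsphere (T * (k - 1) - 1)"
    using runless_avoiding_eq_join_of_simplex_boundaries[OF _ n]
      join_of_simplex_boundaries_homeomorphic_nsphere[OF T, of "k - 1" ?V] k
    by simp
  then show ?thesis
    using runless_homotopy_equivalent_runless_avoiding[of k n T] k
      homotopy_eqv_trans homeomorphic_imp_homotopy_equivalent_space
    by (metis One_nat_def Suc_leD numeral_2_eq_2)
qed

lemma runless_contractible:
  assumes "n = (k + 1) * t + r" "1 \<le> r" "r < k"
  shows "contractible_space (geometric_realization (runless n k))"
proof -
  have "contractible_space (geometric_realization (runless_avoiding n k t))"
  proof (rule contractible_space_cone[OF _ runless_avoiding_subset])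
    show "B \<in> runless_avoiding n k t"
      if "A \<in> runless_avoiding n k t" "B \<subseteq> A" for A B
      using that by (rule runless_avoiding_down_closed)
    show "insert n S \<in> runless_avoiding n k t" if "S \<in> runless_avoiding n k t" for S
      using assms that by (rule insert_last_runless_avoiding)
  qed simp
  moreover have "geometric_realization (runless n k) homotopy_equivalent_space
      geometric_realization (runless_avoiding n k t)"
    using assms by (intro runless_homotopy_equivalent_runless_avoiding) simp
  ultimately show ?thesis
    using homotopy_equivalent_space_contractibility by blast
qed

text \<open>
  The integer \<open>n\<close> is congruent modulo \<open>k + 1\<close> to \<open>0\<close>, to \<open>k\<close>, or to some \<open>r\<close> with \<open>1 \<le> r < k\<close>. In
  the first case \<open>k \<le> n\<close> guarantees \<open>t \<ge> 1\<close>, so that no subtraction in the dimension is truncated.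
\<close>

theorem theorem3p10:
  fixes n k :: nat
  assumes "2 \<le> k" and "k \<le> n"
  shows "let X = geometric_realization
           (devoid_complex (with_proj (path_graph n)) (with_proj (path_graph k)))
         in
         (\<forall>t::nat. n = (k + 1) * t \<longrightarrow> X homotopy_equivalent_space nsphere (t * k - t - 1)) \<and>
         (\<forall>t::nat. n = (k + 1) * t + k \<longrightarrow> X homotopy_equivalent_space nsphere (t * k - t + k - 2)) \<and>
         ((\<nexists>t::nat. n = (k + 1) * t) \<and> (\<nexists>t::nat. n = (k + 1) * t + k) \<longrightarrow> contractible_space X)"
proof -
  let ?X = "geometric_realization (runless n k)"
  have X: "devoid_complex (with_proj (path_graph n)) (with_proj (path_graph k)) = runless n k"
    using assms by (intro devoid_complex_path_graph) simp
  have "?X homotopy_equivalent_space nsphere (t * k - t - 1)" if n: "n = (k + 1) * t" for t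
  proof -
    have "1 \<le> t" using assms n by (cases t) auto
    moreover have "t * (k - 1) - 1 = t * k - t - 1" by (simp add: diff_mult_distrib2)
    ultimately show ?thesis
      using runless_homotopy_equivalent_nsphere[OF assms(1), of t n] n by simp
  qed
  moreover have "?X homotopy_equivalent_space nsphere (t * k - t + k - 2)"
    if n: "n = (k + 1) * t + k" for t
  proof -
    have "t \<le> t * k" using assms(1) by simp
    then have "(t + 1) * (k - 1) - 1 = t * k - t + k - 2"
      using assms(1) by (simp add: diff_mult_distrib2)
    moreover have "n + 1 = (k + 1) * (t + 1)" using n by simp
    ultimately show ?thesis
      using runless_homotopy_equivalent_nsphere[OF assms(1), of "t + 1" n] by simp
  qed
  moreover have "contractible_space ?X"
    if "\<nexists>t. n = (k + 1) * t" "\<nexists>t. n = (k + 1) * t + k"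
  proof (rule runless_contractible)
    show n: "n = (k + 1) * (n div (k + 1)) + n mod (k + 1)"
      by (rule mult_div_mod_eq[symmetric])
    show "1 \<le> n mod (k + 1)"
      using that(1) n by (metis One_nat_def Suc_leI add_0_right gr0I)
    have "n mod (k + 1) \<noteq> k" using that(2) n by metis
    moreover have "n mod (k + 1) < k + 1" by simp
    ultimately show "n mod (k + 1) < k" by linarith
  qed
  ultimately show ?thesis
    unfolding X Let_def by blast
qed

end
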